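(* For any $k\in\mathbb N$, for almost every $y$, $$ p^{a,k}_T(y)=\sum_{L=\{l_1,\ldots,l_k\},\ l_i\in\mathbb N,\ i=1,\ldots,k} q^L_T(y)\,\mathrm E\big(\widetilde{\mathcal E}^a_{T}\,\big/\,\mathcal X^L_T=y\big), $$ where the sum is over the sets $L=\{l_1,\ldots,l_k\}$ with $l_i\in\mathbb N$, $i=1,\ldots,k$.
   Context: Throughout, $T>0$ is fixed, $a:\mathbb R\to\mathbb R$ is bounded and Lipschitz continuous, $\inf\varnothing=+\infty$. **Arratia flow with drift.** An Arratia flow with drift $a$ is a family $\{X^a(u,t): u\in[0,1], t\in[0,T]\}$, regarded as a random element of the Skorokhod space $D([0,1],C([0,T]))$, such that $X^a(u,\cdot)$ is continuous with $X^a(u,0)=u$; $M(u,t)=X^a(u,t)-u-\int_0^t a(X^a(u,r))dr$ is a standard Wiener process with respect to the common filtration generated by the flow; $X^a(u,t)\le X^a(v,t)$ for $u\le v$; and the joint quadratic covariation of $M(u,\cdot)$ and $M(v,\cdot)$ at time $t$ is $(t-\tau_{u,v})_+$, where $\tau_{u,v}=\inf\{r: X^a(u,r)=X^a(v,r)\}$. The superscript $a$ is dropped when the drift is zero: $X=X^0$. The set $\{X^a(v,T): v\in[0,1]\}$ is almost surely finite. **Density $p^{a,k}_T$.** The $k$-point density $p^{a,k}_T$ is a measurable function on $\mathbb R^k$ such that for every bounded nonnegative measurable $f:\mathbb R^k\to\mathbb R$ $$\mathrm E\sum_{\substack{v_1,\ldots,v_k\in\{X^a(v,T):\, v\in[0,1]\},\\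 v_1,\ldots,v_k\text{ are distinct}}}f(v_1,\ldots,v_k)=\int_{\mathbb R^k}p^{a,k}_T(y)f(y)dy.$$ **Stochastic exponential $\widetilde{\mathcal E}^a_T$.** Let $U=\{u_k: k\in\mathbb N\}$ be a dense subset of $[0,1]$. Put $\tau_1=T$, $\tau_k=\inf\{r:\prod_{j=1}^{k-1}(X(u_k,r)-X(u_j,r))=0\}\wedge T$ for $k\ge2$, and $$I_n=\sum_{k=1}^n\int_0^{\tau_k}a(X(u_k,t))dX(u_k,t),\qquad J_n=\sum_{k=1}^n\int_0^{\tau_k}a^2(X(u_k,t))dt.$$ It is known (and may be assumed) that the limits $I=\lim I_n$ and $J=\lim J_n$ exist in $L_2$ and do not depend on the set $U$, and that the distribution of $X^a$ in $D([0,1],C([0,T]))$ is absolutely continuous with respect to that of $X$ with density $\widetilde{\mathcal E}^a_T=\exp\{I-\frac12J\}$. **Vectors $\mathcal X^L_T$.** List the elements of the set $\{X(v,T): v\in[0,1]\}$ in ascending order, $x_{(l)}$ being the $l$-th one, and let $N$ be their number. Given a set $L=\{l_1,\ldots,l_k\}$, $l_i\in\mathbb N$, $i=1,\ldots,k$, the random vector $\mathcal X^L_T$ with values in $\mathbb R^k\cup\{\varkappa\}$ equals $(x_{(l_1)},\ldots,x_{(l_k)})$ if $\max_i l_i\le N$, and equals $\varkappa$ (a cemetery state outside $\mathbb R^k$) otherwise. $q^L_T(\cdot)$ is the density of $\mathcal X^L_T$ in $\mathbb R^k$, that is, the density with respect to Lebesgue measure of the restriction to $\mathbb R^k$ of the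 law of $\mathcal X^L_T$ (its integral may be less than $1$). $\mathrm E(\cdot/\mathcal X^L_T=y)$ denotes the conditional expectation given $\mathcal X^L_T$ as a function of the value $y$. *)

theory Defs
  imports "HOL-Probability.Probability"
begin

section \<open>The Skorokhod space \<open>D([0,1], E)\<close>\<close>

definition skorokhod_space :: "'a metric \<Rightarrow> (real \<Rightarrow> 'a) set" where
  "skorokhod_space m =
     {f \<in> {0..1} \<rightarrow>\<^sub>E mspace m.
        (\<forall>u\<in>{0..<1}. limitin (mtopology_of m) f (f u) (at_right u)) \<and>
        (\<forall>u\<in>{0<..1}. \<exists>l. limitin (mtopology_of m) f l (at_left u))}"

definition time_change :: "(real \<Rightarrow> real) \<Rightarrow> bool" where
  "time_change \<theta> \<longleftrightarrow> strict_mono_on {0..1} \<theta> \<and> \<theta> ` {0..1} = {0..1}"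

definition skorokhod_close :: "'a metric \<Rightarrow> real \<Rightarrow> (real \<Rightarrow> 'a) \<Rightarrow> (real \<Rightarrow> 'a) \<Rightarrow> bool" where
  "skorokhod_close m \<epsilon> f g \<longleftrightarrow>
     (\<exists>\<theta>. time_change \<theta> \<and>
        (\<forall>u\<in>{0..1}. \<bar>\<theta> u - u\<bar> < \<epsilon> \<and> mdist m (f u) (g (\<theta> u)) < \<epsilon>))"

text \<open>The topology of the Skorokhod metric
  \<open>inf\<^sub>\<theta> max (sup\<^sub>u \<bar>\<theta> u - u\<bar>) (sup\<^sub>u d(f u, g (\<theta> u)))\<close>, given by its balls.\<close>

definition skorokhod_topology :: "'a metric \<Rightarrow> (real \<Rightarrow> 'a) topology" where
  "skorokhod_topology m = topology (\<lambda>W. W \<subseteq> skorokhod_space m \<and>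
     (\<forall>f\<in>W. \<exists>\<epsilon>>0. \<forall>g\<in>skorokhod_space m. skorokhod_close m \<epsilon> f g \<longrightarrow> g \<in> W))"

lemma skorokhod_close_mono: "skorokhod_close m \<epsilon> f g \<Longrightarrow> \<epsilon> \<le> \<delta> \<Longrightarrow> skorokhod_close m \<delta> f g"
  unfolding skorokhod_close_def by (meson less_le_trans)

lemma openin_skorokhod_topology:
  "openin (skorokhod_topology m) W \<longleftrightarrow> W \<subseteq> skorokhod_space m \<and>
     (\<forall>f\<in>W. \<exists>\<epsilon>>0. \<forall>g\<in>skorokhod_space m. skorokhod_close m \<epsilon> f g \<longrightarrow> g \<in> W)"
proof -
  let ?op = "\<lambda>W. W \<subseteq> skorokhod_space m \<and>
     (\<forall>f\<in>W. \<exists>\<epsilon>>0. \<forall>g\<in>skorokhod_space m. skorokhod_close m \<epsilon> f g \<longrightarrow> g \<in> W)"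
  have "?op (S \<inter> S')" if S: "?op S" and S': "?op S'" for S S'
  proof (intro conjI ballI)
    fix f assume f: "f \<in> S \<inter> S'"
    obtain \<epsilon> where \<epsilon>: "\<epsilon> > 0" "\<forall>g\<in>skorokhod_space m. skorokhod_close m \<epsilon> f g \<longrightarrow> g \<in> S"
      using S f by blast
    obtain \<delta> where \<delta>: "\<delta> > 0" "\<forall>g\<in>skorokhod_space m. skorokhod_close m \<delta> f g \<longrightarrow> g \<in> S'"
      using S' f by blast
    show "\<exists>\<epsilon>>0. \<forall>g\<in>skorokhod_space m. skorokhod_close m \<epsilon> f g \<longrightarrow> g \<in> S \<inter> S'"
      using \<epsilon> \<delta> skorokhod_close_mono[of m "min \<epsilon> \<delta>" f]
      by (intro exI[of _ "min \<epsilon> \<delta>"]) auto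
  qed (use S in auto)
  moreover have "?op (\<Union>K)" if K: "\<forall>S\<in>K. ?op S" for K
  proof (intro conjI ballI)
    show "\<Union>K \<subseteq> skorokhod_space m" using K by blast
  next
    fix f assume "f \<in> \<Union>K"
    then obtain S where S: "S \<in> K" "f \<in> S" by blast
    then obtain \<epsilon> where "\<epsilon> > 0" "\<forall>g\<in>skorokhod_space m. skorokhod_close m \<epsilon> f g \<longrightarrow> g \<in> S"
      using K by blast
    with S show "\<exists>\<epsilon>>0. \<forall>g\<in>skorokhod_space m. skorokhod_close m \<epsilon> f g \<longrightarrow> g \<in> \<Union>K"
      by blast
  qed
  ultimately have "istopology ?op"
    unfolding istopology_def by blast
  then show ?thesis
    by (simp add: skorokhod_topology_def topology_inverse')
qed

definition path_space :: "real \<Rightarrow> (real \<Rightarrow> real) metric" where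
  "path_space T = cfunspace (top_of_set {0..T}) euclidean_metric"

definition skorokhod_borel :: "real \<Rightarrow> (real \<Rightarrow> real \<Rightarrow> real) measure" where
  "skorokhod_borel T = sigma (skorokhod_space (path_space T))
     {W. openin (skorokhod_topology (path_space T)) W}"

section \<open>Wiener processes, quadratic covariation, Ito integrals\<close>

definition wiener_process ::
    "'w measure \<Rightarrow> (real \<Rightarrow> 'w measure) \<Rightarrow> real \<Rightarrow> (real \<Rightarrow> 'w \<Rightarrow> real) \<Rightarrow> bool" where
  "wiener_process M F T W \<longleftrightarrow>
     (\<forall>t\<in>{0..T}. W t \<in> borel_measurable (F t)) \<and>
     (AE \<omega> in M. W 0 \<omega> = 0) \<and>
     (AE \<omega> in M. continuous_on {0..T} (\<lambda>t. W t \<omega>)) \<and>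
     (\<forall>s t. 0 \<le> s \<and> s < t \<and> t \<le> T \<longrightarrow>
        distributed M lborel (\<lambda>\<omega>. W t \<omega> - W s \<omega>) (\<lambda>x. ennreal (normal_density 0 (sqrt (t - s)) x)) \<and>
        prob_space.indep_set M (sets (F s))
          {(\<lambda>\<omega>. W t \<omega> - W s \<omega>) -` B \<inter> space M | B. B \<in> sets borel})"

definition tendsto_in_prob :: "'w measure \<Rightarrow> (nat \<Rightarrow> 'w \<Rightarrow> real) \<Rightarrow> ('w \<Rightarrow> real) \<Rightarrow> bool" where
  "tendsto_in_prob M f g \<longleftrightarrow>
     (\<forall>n. f n \<in> borel_measurable M) \<and> g \<in> borel_measurable M \<and>
     (\<forall>\<epsilon>>0. (\<lambda>n. measure M {\<omega> \<in> space M. \<bar>f n \<omega> - g \<omega>\<bar> > \<epsilon>}) \<longlonglongrightarrow> 0)"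

definition tendsto_in_L2 :: "'w measure \<Rightarrow> (nat \<Rightarrow> 'w \<Rightarrow> real) \<Rightarrow> ('w \<Rightarrow> real) \<Rightarrow> bool" where
  "tendsto_in_L2 M f g \<longleftrightarrow>
     (\<forall>n. f n \<in> borel_measurable M \<and> integrable M (\<lambda>\<omega>. (f n \<omega>)\<^sup>2)) \<and>
     g \<in> borel_measurable M \<and> integrable M (\<lambda>\<omega>. (g \<omega>)\<^sup>2) \<and>
     (\<lambda>n. \<integral>\<^sup>+\<omega>. ennreal ((f n \<omega> - g \<omega>)\<^sup>2) \<partial>M) \<longlonglongrightarrow> 0"

text \<open>\<open>A t\<close> is the limit in probability of \<open>\<Sum>\<^sub>i (V s\<^sub>i\<^sub>+\<^sub>1 - V s\<^sub>i) (W s\<^sub>i\<^sub>+\<^sub>1 - W s\<^sub>i)\<close> along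
  every sequence of partitions \<open>0 = s\<^sub>0 \<le> \<dots> \<le> s\<^sub>k = t\<close> whose mesh tends to zero.\<close>

definition quadratic_covariation ::
    "'w measure \<Rightarrow> real \<Rightarrow> (real \<Rightarrow> 'w \<Rightarrow> real) \<Rightarrow> (real \<Rightarrow> 'w \<Rightarrow> real) \<Rightarrow> (real \<Rightarrow> 'w \<Rightarrow> real) \<Rightarrow> bool" where
  "quadratic_covariation M T V W A \<longleftrightarrow>
     (\<forall>t\<in>{0..T}. \<forall>(k :: nat \<Rightarrow> nat) (s :: nat \<Rightarrow> nat \<Rightarrow> real).
        (\<forall>n. s n 0 = 0 \<and> s n (k n) = t \<and> (\<forall>i<k n. s n i \<le> s n (Suc i))) \<and>
        (\<forall>\<delta>>0. \<forall>\<^sub>F n in sequentially. \<forall>i<k n. s n (Suc i) - s n i < \<delta>) \<longrightarrow>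
        tendsto_in_prob M
          (\<lambda>n \<omega>. \<Sum>i<k n. (V (s n (Suc i)) \<omega> - V (s n i) \<omega>) * (W (s n (Suc i)) \<omega> - W (s n i) \<omega>))
          (A t))"

definition elementary_data ::
    "(real \<Rightarrow> 'w measure) \<Rightarrow> real \<Rightarrow> nat \<Rightarrow> (nat \<Rightarrow> real) \<Rightarrow> (nat \<Rightarrow> 'w \<Rightarrow> real) \<Rightarrow> bool" where
  "elementary_data F T m s \<xi> \<longleftrightarrow>
     0 \<le> s 0 \<and> s m \<le> T \<and> (\<forall>i<m. s i \<le> s (Suc i)) \<and>
     (\<forall>i<m. \<xi> i \<in> borel_measurable (F (s i)) \<and> bounded (\<xi> i ` space (F (s i))))"

definition elementary_process ::
    "nat \<Rightarrow> (nat \<Rightarrow> real) \<Rightarrow> (nat \<Rightarrow> 'w \<Rightarrow> real) \<Rightarrow> real \<Rightarrow> 'w \<Rightarrow> real" where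
  "elementary_process m s \<xi> t \<omega> = (\<Sum>i<m. \<xi> i \<omega> * indicator {s i<..s (Suc i)} t)"

definition elementary_integral ::
    "(real \<Rightarrow> 'w \<Rightarrow> real) \<Rightarrow> nat \<Rightarrow> (nat \<Rightarrow> real) \<Rightarrow> (nat \<Rightarrow> 'w \<Rightarrow> real) \<Rightarrow> 'w \<Rightarrow> real" where
  "elementary_integral W m s \<xi> \<omega> = (\<Sum>i<m. \<xi> i \<omega> * (W (s (Suc i)) \<omega> - W (s i) \<omega>))"

text \<open>\<open>Z\<close> is a version of \<open>\<integral>\<^sub>0\<^sup>T H dW\<close>: the limit in \<open>L\<^sub>2\<close> of the integrals of elementary
  processes that approximate \<open>H\<close> in \<open>L\<^sub>2(dt \<otimes> dP)\<close>. By the Ito isometry it does not depend, up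
  to null sets, on the approximating sequence when \<open>W\<close> is (up to its starting point) a Wiener
  process with respect to \<open>F\<close>.\<close>

definition is_ito_integral ::
    "'w measure \<Rightarrow> (real \<Rightarrow> 'w measure) \<Rightarrow> real \<Rightarrow> (real \<Rightarrow> 'w \<Rightarrow> real) \<Rightarrow> (real \<Rightarrow> 'w \<Rightarrow> real)
      \<Rightarrow> ('w \<Rightarrow> real) \<Rightarrow> bool" where
  "is_ito_integral M F T W H Z \<longleftrightarrow>
     (\<lambda>(t, \<omega>). H t \<omega>) \<in> borel_measurable (restrict_space lborel {0..T} \<Otimes>\<^sub>M M) \<and>
     (\<exists>m s \<xi>.
        (\<forall>n. elementary_data F T (m n) (s n) (\<xi> n)) \<and>
        (\<lambda>n. \<integral>\<^sup>+(t, \<omega>). ennreal ((elementary_process (m n) (s n) (\<xi> n) t \<omega> - H t \<omega>)\<^sup>2)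
                \<partial>(restrict_space lborel {0..T} \<Otimes>\<^sub>M M)) \<longlonglongrightarrow> 0 \<and>
        tendsto_in_L2 M (\<lambda>n. elementary_integral W (m n) (s n) (\<xi> n)) Z)"

section \<open>Arratia flows\<close>

definition flow_filtration :: "'w measure \<Rightarrow> (real \<Rightarrow> real \<Rightarrow> 'w \<Rightarrow> real) \<Rightarrow> real \<Rightarrow> 'w measure" where
  "flow_filtration M X t = sigma (space M)
     {X v s -` B \<inter> space M | v s B. v \<in> {0..1} \<and> s \<in> {0..t} \<and> B \<in> sets borel}"

definition flow_path :: "real \<Rightarrow> (real \<Rightarrow> real \<Rightarrow> 'w \<Rightarrow> real) \<Rightarrow> 'w \<Rightarrow> real \<Rightarrow> real \<Rightarrow> real" where
  "flow_path T X \<omega> = (\<lambda>u\<in>{0..1}. \<lambda>t\<in>{0..T}. X u t \<omega>)"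

definition martingale_part ::
    "(real \<Rightarrow> real) \<Rightarrow> (real \<Rightarrow> real \<Rightarrow> 'w \<Rightarrow> real) \<Rightarrow> real \<Rightarrow> real \<Rightarrow> 'w \<Rightarrow> real" where
  "martingale_part a X u t \<omega> = X u t \<omega> - u - (LBINT r:{0..t}. a (X u r \<omega>))"

text \<open>Valued in \<^typ>\<open>ereal\<close>, so that the infimum of the empty set is \<open>\<infinity>\<close>.\<close>

definition meeting_time ::
    "real \<Rightarrow> (real \<Rightarrow> real \<Rightarrow> 'w \<Rightarrow> real) \<Rightarrow> real \<Rightarrow> real \<Rightarrow> 'w \<Rightarrow> ereal" where
  "meeting_time T X u v \<omega> = Inf {ereal r | r. r \<in> {0..T} \<and> X u r \<omega> = X v r \<omega>}"

text \<open>Continuity of \<open>X u\<close> on \<open>[0,T]\<close> is part of the membership of the paths in \<open>D([0,1], C([0,T]))\<close>.\<close>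

definition arratia_flow ::
    "'w measure \<Rightarrow> real \<Rightarrow> (real \<Rightarrow> real) \<Rightarrow> (real \<Rightarrow> real \<Rightarrow> 'w \<Rightarrow> real) \<Rightarrow> bool" where
  "arratia_flow M T a X \<longleftrightarrow>
     prob_space M \<and>
     flow_path T X \<in> measurable M (skorokhod_borel T) \<and>
     (\<forall>u\<in>{0..1}. AE \<omega> in M. X u 0 \<omega> = u) \<and>
     (\<forall>u\<in>{0..1}. wiener_process M (flow_filtration M X) T (martingale_part a X u)) \<and>
     (\<forall>u\<in>{0..1}. \<forall>v\<in>{0..1}. u \<le> v \<longrightarrow> (AE \<omega> in M. \<forall>t\<in>{0..T}. X u t \<omega> \<le> X v t \<omega>)) \<and>
     (\<forall>u\<in>{0..1}. \<forall>v\<in>{0..1}.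
        quadratic_covariation M T (martingale_part a X u) (martingale_part a X v)
          (\<lambda>t \<omega>. real_of_ereal (max 0 (ereal t - meeting_time T X u v \<omega>))))"

definition flow_values :: "real \<Rightarrow> (real \<Rightarrow> real \<Rightarrow> 'w \<Rightarrow> real) \<Rightarrow> 'w \<Rightarrow> real set" where
  "flow_values T X \<omega> = (\<lambda>v. X v T \<omega>) ` {0..1}"

section \<open>Point densities\<close>

text \<open>The sum is over ordered \<open>k\<close>-tuples of distinct points, \<open>k = CARD('k)\<close>. The condition
  \<open>p \<ge> 0\<close> a.e. makes \<open>\<integral>\<^sup>+ ennreal (p y * f y)\<close> the integral of \<open>p f\<close>.\<close>

definition point_density ::
    "'w measure \<Rightarrow> real \<Rightarrow> (real \<Rightarrow> real \<Rightarrow> 'w \<Rightarrow> real) \<Rightarrow> (real ^ 'k \<Rightarrow> real) \<Rightarrow> bool" where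
  "point_density M T X p \<longleftrightarrow>
     p \<in> borel_measurable borel \<and> (AE y in lborel. 0 \<le> p y) \<and>
     (\<forall>f :: real ^ 'k \<Rightarrow> real.
        f \<in> borel_measurable borel \<and> (\<forall>y. 0 \<le> f y) \<and> bounded (range f) \<longrightarrow>
        (\<integral>\<^sup>+\<omega>. (\<Sum>\<^sub>\<infinity>v\<in>{v. (\<forall>i. v $ i \<in> flow_values T X \<omega>) \<and> inj (\<lambda>i. v $ i)}. ennreal (f v)) \<partial>M)
          = (\<integral>\<^sup>+y. ennreal (p y * f y) \<partial>lborel))"

section \<open>The stochastic exponential\<close>

text \<open>The dense sequence is indexed from \<open>0\<close>; for \<open>k = 0\<close> the product is empty and the value is \<open>T\<close>.\<close>

definition stop_time ::
    "real \<Rightarrow> (real \<Rightarrow> real \<Rightarrow> 'w \<Rightarrow> real) \<Rightarrow> (nat \<Rightarrow> real) \<Rightarrow> nat \<Rightarrow> 'w \<Rightarrow> real" where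
  "stop_time T X u k \<omega> = real_of_ereal
     (min (Inf {ereal r | r. r \<in> {0..T} \<and> (\<Prod>j<k. X (u k) r \<omega> - X (u j) r \<omega>) = 0}) (ereal T))"

text \<open>\<open>I\<close> and \<open>J\<close> are (versions of) the \<open>L\<^sub>2\<close>-limits of \<open>I\<^sub>n\<close> and \<open>J\<^sub>n\<close>; \<open>S k\<close> is a version of
  \<open>\<integral>\<^sub>0\<^sup>\<tau> a(X(u\<^sub>k,t)) dX(u\<^sub>k,t)\<close> for \<open>\<tau> = stop_time T X u k\<close>.\<close>

definition exponent_limits ::
    "'w measure \<Rightarrow> real \<Rightarrow> (real \<Rightarrow> real) \<Rightarrow> (real \<Rightarrow> real \<Rightarrow> 'w \<Rightarrow> real) \<Rightarrow> (nat \<Rightarrow> real)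
      \<Rightarrow> ('w \<Rightarrow> real) \<Rightarrow> ('w \<Rightarrow> real) \<Rightarrow> bool" where
  "exponent_limits M T a X u I J \<longleftrightarrow>
     (\<exists>S. (\<forall>k. is_ito_integral M (flow_filtration M X) T (X (u k))
                (\<lambda>t \<omega>. indicator {0..stop_time T X u k \<omega>} t * a (X (u k) t \<omega>)) (S k)) \<and>
          tendsto_in_L2 M (\<lambda>n \<omega>. \<Sum>k<n. S k \<omega>) I) \<and>
     tendsto_in_L2 M (\<lambda>n \<omega>. \<Sum>k<n. LBINT t:{0..stop_time T X u k \<omega>}. (a (X (u k) t \<omega>))\<^sup>2) J"

definition stochastic_exponential :: "('w \<Rightarrow> real) \<Rightarrow> ('w \<Rightarrow> real) \<Rightarrow> 'w \<Rightarrow> real" where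
  "stochastic_exponential I J \<omega> = exp (I \<omega> - J \<omega> / 2)"

text \<open>The law of \<open>X'\<close> (on \<open>M'\<close>) has density \<open>Z\<close> with respect to that of \<open>X\<close> (on \<open>M\<close>), \<open>Z\<close> being
  a.s. a measurable function of the path of \<open>X\<close>.\<close>

definition flow_law_density ::
    "'w measure \<Rightarrow> 'v measure \<Rightarrow> real \<Rightarrow> (real \<Rightarrow> real \<Rightarrow> 'w \<Rightarrow> real) \<Rightarrow> (real \<Rightarrow> real \<Rightarrow> 'v \<Rightarrow> real)
      \<Rightarrow> ('w \<Rightarrow> real) \<Rightarrow> bool" where
  "flow_law_density M M' T X X' Z \<longleftrightarrow>
     (\<exists>h \<in> borel_measurable (skorokhod_borel T).
        (AE \<omega> in M. Z \<omega> = h (flow_path T X \<omega>)) \<and>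
        distr M' (skorokhod_borel T) (flow_path T X') =
          density (distr M (skorokhod_borel T) (flow_path T X)) (\<lambda>x. ennreal (h x)))"

section \<open>The vectors of order statistics\<close>

text \<open>An index set \<open>L = {l\<^sub>1, \<dots>, l\<^sub>k}\<close> of \<open>k = CARD('k)\<close> positive integers is given together with
  its enumeration, which fixes the order of the coordinates of the random vector; correspondingly
  the sum over \<open>L\<close> runs over all enumerations. This is the reading in which the resulting sum is a
  symmetric function of \<open>y\<close>, like the density in \<open>point_density\<close>. For \<open>y\<close> with ascending
  coordinates only the ascending enumeration of each set contributes (for a.e. such \<open>y\<close>).\<close>

definition index_tuples :: "('k::finite \<Rightarrow> nat) set" where
  "index_tuples = {l. inj l \<and> (\<forall>i. 1 \<le> l i)}"

text \<open>\<^const>\<open>None\<close> is the cemetery state.\<close>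

definition order_vector ::
    "real \<Rightarrow> (real \<Rightarrow> real \<Rightarrow> 'w \<Rightarrow> real) \<Rightarrow> ('k \<Rightarrow> nat) \<Rightarrow> 'w \<Rightarrow> (real ^ 'k) option" where
  "order_vector T X l \<omega> =
     (if \<forall>i. l i \<le> card (flow_values T X \<omega>)
      then Some (\<chi> i. sorted_list_of_set (flow_values T X \<omega>) ! (l i - 1))
      else None)"

definition cemetery_borel :: "(real ^ 'k) option measure" where
  "cemetery_borel = sigma UNIV {B. Some -` B \<in> sets borel}"

definition order_vector_density ::
    "'w measure \<Rightarrow> real \<Rightarrow> (real \<Rightarrow> real \<Rightarrow> 'w \<Rightarrow> real) \<Rightarrow> ('k \<Rightarrow> nat) \<Rightarrow> (real ^ 'k \<Rightarrow> real) \<Rightarrow> bool" where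
  "order_vector_density M T X l q \<longleftrightarrow>
     q \<in> borel_measurable borel \<and> (AE y in lborel. 0 \<le> q y) \<and>
     (\<forall>B\<in>sets borel. emeasure (distr M cemetery_borel (order_vector T X l)) (Some ` B)
        = (\<integral>\<^sup>+y\<in>B. ennreal (q y) \<partial>lborel))"

text \<open>\<open>e\<close> is a version of \<open>y \<mapsto> E(Z | Y = y)\<close>, for \<open>Y\<close> with values in \<open>N\<close>.\<close>

definition is_cond_exp_given ::
    "'w measure \<Rightarrow> 'b measure \<Rightarrow> ('w \<Rightarrow> 'b) \<Rightarrow> ('w \<Rightarrow> real) \<Rightarrow> ('b \<Rightarrow> real) \<Rightarrow> bool" where
  "is_cond_exp_given M N Y Z e \<longleftrightarrow>
     e \<in> borel_measurable N \<and>
     (AE \<omega> in M. e (Y \<omega>) = real_cond_exp M (vimage_algebra (space M) Y N) Z \<omega>)"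

end

theory Submission
  imports Defs
begin

text \<open>Testing the density of \<open>X\<^sup>a\<close> against an indicator \<open>1\<^sub>B\<close> and splitting the sum over tuples
  of distinct points according to their ranks turns \<open>\<integral>\<^sub>B p\<close> into the sum over \<open>L\<close> of the
  probabilities that the \<open>L\<close>-th order vector of \<open>X\<^sup>a\<close> lies in \<open>B\<close>. The order vectors are measurable
  functionals on the Skorokhod space, so the density of the law of \<open>X\<^sup>a\<close> moves each probability to
  the driftless flow, where conditioning on its order vector gives \<open>\<integral>\<^sub>B q\<^sub>L(y) E(Z | y) dy\<close>.\<close>

section \<open>The cemetery state\<close>

lemma space_cemetery_borel [simp]: "space cemetery_borel = UNIV"
  by (simp add: cemetery_borel_def space_measure_of_conv)

text \<open>Preimages under \<open>Some\<close> commute with complements and countable unions, so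
  the generating family is already a sigma-algebra; membership of \<open>None\<close> never affects
  measurability.\<close>

lemma sets_cemetery_borel:
  "sets cemetery_borel = {B :: (real ^ 'k) option set. Some -` B \<in> sets borel}"
proof -
  have "sigma_algebra UNIV {B :: (real ^ 'k) option set. Some -` B \<in> sets borel}"
    by (rule sigma_algebra_iff2[THEN iffD2]) (auto simp: vimage_Union vimage_UN Compl_eq_Diff_UNIV[symmetric] vimage_Compl)
  then show ?thesis
    unfolding cemetery_borel_def by (rule sigma_algebra.sets_measure_of_eq)
qed

lemma Some_image_in_sets [measurable]:
  "B \<in> sets borel \<Longrightarrow> Some ` B \<in> sets cemetery_borel"
  by (simp add: sets_cemetery_borel inj_vimage_image_eq)

lemma measurable_Some_cemetery [measurable]: "Some \<in> measurable borel cemetery_borel"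
  by (rule measurableI) (auto simp: sets_cemetery_borel)

text \<open>Replacing the vector by 0 off the domain \<open>P\<close> gives a total measurable map
  into the Euclidean space. Its preimages are cut down to \<open>P\<close>, and \<open>None\<close>
  accounts for the complement.\<close>

lemma measurable_cemetery_option:
  assumes D: "{x \<in> space N. P x} \<in> sets N"
    and g: "\<And>i. (\<lambda>x. if P x then g x $ i else 0) \<in> borel_measurable N"
  shows "(\<lambda>x. if P x then Some (g x :: real ^ 'k) else None) \<in> measurable N cemetery_borel"
proof (rule measurableI)
  fix B :: "(real ^ 'k) option set" assume "B \<in> sets cemetery_borel"
  then have B: "Some -` B \<in> sets borel" by (simp add: sets_cemetery_borel)
  define G where "G x = (if P x then g x else 0)" for x
  have "G \<in> borel_measurable N"
  proof (rule borel_measurable_euclidean_space[THEN iffD2], rule ballI)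
    fix b :: "real ^ 'k" assume "b \<in> Basis"
    then obtain i where "b = axis i 1" by (auto simp: Basis_vec_def)
    moreover have "(\<lambda>x. G x $ i) \<in> borel_measurable N"
      using g[of i] unfolding G_def by (simp add: if_distrib[of "\<lambda>v. v $ i"] cong: if_cong)
    ultimately show "(\<lambda>x. G x \<bullet> b) \<in> borel_measurable N"
      by (simp add: cart_eq_inner_axis)
  qed
  then have "G -` (Some -` B) \<inter> space N \<in> sets N"
    using B by (rule measurable_sets)
  moreover have "(\<lambda>x. if P x then Some (g x) else None) -` B \<inter> space N =
     ({x \<in> space N. P x} \<inter> (G -` (Some -` B) \<inter> space N)) \<union>
     ((if None \<in> B then space N else {}) - {x \<in> space N. P x})"
    by (auto simp: G_def split: if_splits)
  ultimately show "(\<lambda>x. if P x then Some (g x) else None) -` B \<inter> space N \<in> sets N"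
    using D by auto
qed simp

section \<open>Laws on the cemetery space and their restrictions to the Euclidean part\<close>

text \<open>\<open>Some\<close> is a measurable isomorphism onto its range with inverse
  \<open>the\<close>. Restricting \<open>N\<close> to that range discards the mass at
  \<open>None\<close>, and what remains is \<open>K\<close>.\<close>

lemma cemetery_restrict_measure:
  fixes K :: "(real ^ 'k) measure"
  assumes N: "sets N = sets cemetery_borel" and K: "sets K = sets borel"
    and eq: "\<And>B. B \<in> sets borel \<Longrightarrow> emeasure N (Some ` B) = emeasure K B"
  shows "K = distr (restrict_space N (range Some)) borel the"
    and "the \<in> measurable (restrict_space N (range Some)) borel"
proof -
  have R: "range Some \<in> sets N" by (simp add: N Some_image_in_sets)
  have sp: "space N = UNIV" using sets_eq_imp_space_eq[OF N] by simp
  have vim: "the -` B \<inter> space (restrict_space N (range Some)) = Some ` B" for B :: "(real ^ 'k) set"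
    by (auto simp: space_restrict_space sp)
  show m: "the \<in> measurable (restrict_space N (range Some)) borel"
  proof (rule measurableI)
    fix B :: "(real ^ 'k) set" assume "B \<in> sets borel"
    then show "the -` B \<inter> space (restrict_space N (range Some)) \<in> sets (restrict_space N (range Some))"
      unfolding vim using R by (auto simp: sets_restrict_space_iff sp N Some_image_in_sets)
  qed simp
  show "K = distr (restrict_space N (range Some)) borel the"
  proof (rule measure_eqI)
    fix B assume "B \<in> sets K"
    then have B: "B \<in> sets borel" by (simp add: K)
    have "emeasure (distr (restrict_space N (range Some)) borel the) B
      = emeasure (restrict_space N (range Some)) (Some ` B)"
      by (simp add: emeasure_distr[OF m B] vim)
    also have "\<dots> = emeasure N (Some ` B)"
      by (rule emeasure_restrict_space) (use R in \<open>auto simp: sp\<close>)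
    finally show "emeasure K B = emeasure (distr (restrict_space N (range Some)) borel the) B"
      using eq[OF B] by simp
  qed (simp add: K)
qed

lemma nn_integral_cemetery:
  fixes K :: "(real ^ 'k) measure"
  assumes N: "sets N = sets cemetery_borel" and K: "sets K = sets borel"
    and eq: "\<And>B. B \<in> sets borel \<Longrightarrow> emeasure N (Some ` B) = emeasure K B"
    and g: "g \<in> borel_measurable cemetery_borel"
  shows "(\<integral>\<^sup>+z. g z * indicator (range Some) z \<partial>N) = (\<integral>\<^sup>+y. g (Some y) \<partial>K)"
proof -
  note KN = cemetery_restrict_measure[OF N K eq, simplified]
  have R: "range Some \<in> sets N" by (simp add: N Some_image_in_sets)
  have sp: "space N = UNIV" using sets_eq_imp_space_eq[OF N] by simp
  have "(\<integral>\<^sup>+y. g (Some y) \<partial>K) = (\<integral>\<^sup>+z. g (Some (the z)) \<partial>restrict_space N (range Some))"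
    using measurable_compose[OF measurable_Some_cemetery g]
    by (subst KN(1)) (simp add: nn_integral_distr KN(2))
  also have "\<dots> = (\<integral>\<^sup>+z. g (Some (the z)) * indicator (range Some) z \<partial>N)"
    by (rule nn_integral_restrict_space) (use R in \<open>simp add: sp\<close>)
  also have "\<dots> = (\<integral>\<^sup>+z. g z * indicator (range Some) z \<partial>N)"
    by (rule nn_integral_cong) (auto simp: indicator_def)
  finally show ?thesis by simp
qed

text \<open>\<open>Some\<close> maps the exceptional set in the Euclidean space into the exceptional
  set of \<open>N\<close>, and the two measures agree on such images.\<close>

lemma AE_cemetery:
  fixes K :: "(real ^ 'k) measure"
  assumes N: "sets N = sets cemetery_borel" and K: "sets K = sets borel"
    and eq: "\<And>B. B \<in> sets borel \<Longrightarrow> emeasure N (Some ` B) = emeasure K B"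
    and P: "AE z in N. P z" and meas: "{z. P z} \<in> sets cemetery_borel"
  shows "AE y in K. P (Some y)"
proof -
  have sp: "space N = UNIV" "space K = UNIV"
    using sets_eq_imp_space_eq[OF N] sets_eq_imp_space_eq[OF K] by simp_all
  have B: "{y. \<not> P (Some y)} \<in> sets borel"
    using meas unfolding sets_cemetery_borel
    by (auto simp: vimage_def dest: borel_comp[of "{y. P (Some y)}"] simp flip: Collect_neg_eq)
  have "Some ` {y. \<not> P (Some y)} \<in> null_sets N"
  proof -
    have "{z. \<not> P z} \<in> sets N"
      using meas unfolding N sets_cemetery_borel by (auto simp: vimage_def B)
    then have "emeasure N {z. \<not> P z} = 0"
      using P by (simp add: AE_iff_measurable sp)
    moreover have "emeasure N (Some ` {y. \<not> P (Some y)}) \<le> emeasure N {z. \<not> P z}"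
      using \<open>{z. \<not> P z} \<in> sets N\<close> by (intro emeasure_mono) auto
    ultimately show ?thesis
      using B by (auto simp: N Some_image_in_sets intro!: null_setsI)
  qed
  then have "emeasure K {y. \<not> P (Some y)} = 0"
    using eq[OF B] by (simp add: null_setsD1)
  then show ?thesis
    using B by (subst AE_iff_measurable[OF _ refl]) (auto simp: K sp)
qed

section \<open>Measurability on the Skorokhod space\<close>

lemma space_skorokhod_borel: "space (skorokhod_borel T) = skorokhod_space (path_space T)"
  by (simp add: skorokhod_borel_def space_measure_of_conv)

lemma openin_in_sets_skorokhod_borel:
  "openin (skorokhod_topology (path_space T)) W \<Longrightarrow> W \<in> sets (skorokhod_borel T)"
  unfolding skorokhod_borel_def
  by (subst sets_measure_of) (auto simp: openin_skorokhod_topology)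

text \<open>A time change moves the time at which an open set is visited but cannot destroy the visit;
  so visits to open sets are open events, unlike events about the value at a fixed \<open>v\<close>.\<close>

lemma hitting_openin:
  assumes t: "t \<in> {0..T}" and G: "open G"
  shows "openin (skorokhod_topology (path_space T))
    {x \<in> skorokhod_space (path_space T). \<exists>v\<in>{0..1}. x v t \<in> G}"
  unfolding openin_skorokhod_topology
proof (intro conjI ballI)
  fix f assume "f \<in> {x \<in> skorokhod_space (path_space T). \<exists>v\<in>{0..1}. x v t \<in> G}"
  then obtain v where f: "f \<in> skorokhod_space (path_space T)" and v: "v \<in> {0..1}" "f v t \<in> G"
    by blast
  obtain \<epsilon> where \<epsilon>: "\<epsilon> > 0" "\<And>y. dist y (f v t) < \<epsilon> \<Longrightarrow> y \<in> G"
    using G v(2) unfolding open_dist by blast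
  have "g \<in> {x \<in> skorokhod_space (path_space T). \<exists>v\<in>{0..1}. x v t \<in> G}"
    if g: "g \<in> skorokhod_space (path_space T)" and c: "skorokhod_close (path_space T) \<epsilon> f g" for g
  proof -
    obtain \<theta> where \<theta>: "time_change \<theta>" "mdist (path_space T) (f v) (g (\<theta> v)) < \<epsilon>"
      using c v(1) unfolding skorokhod_close_def by blast
    have \<theta>v: "\<theta> v \<in> {0..1}" using \<theta>(1) v(1) unfolding time_change_def by blast
    \<comment> \<open>The uniform metric on paths dominates the distance between the values at the
      single time \<open>t\<close>.\<close>
    have "f v \<in> mspace (path_space T)" "g (\<theta> v) \<in> mspace (path_space T)"
      using f g v(1) \<theta>v unfolding skorokhod_space_def by auto
    then have "mdist euclidean_metric (f v t) (g (\<theta> v) t) \<le> mdist (path_space T) (f v) (g (\<theta> v))"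
      unfolding path_space_def using t
      by (intro mdist_cfunspace_imp_mdist_le[OF _ _ order_refl]) auto
    then have "g (\<theta> v) t \<in> G"
      using \<theta>(2) by (intro \<epsilon>(2)) (simp add: dist_commute)
    then show ?thesis using g \<theta>v by blast
  qed
  then show "\<exists>\<epsilon>>0. \<forall>g\<in>skorokhod_space (path_space T). skorokhod_close (path_space T) \<epsilon> f g \<longrightarrow>
      g \<in> {x \<in> skorokhod_space (path_space T). \<exists>v\<in>{0..1}. x v t \<in> G}"
    using \<epsilon>(1) by blast
qed auto

section \<open>Counting points below a level by countably many hitting events\<close>

text \<open>A witness set is used instead of \<open>card (V \<inter> {..<c})\<close>, because
  \<open>V\<close> may be infinite and \<open>card\<close> of an infinite set is 0.\<close>

definition has_points_below :: "nat \<Rightarrow> real set \<Rightarrow> real \<Rightarrow> bool" where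
  "has_points_below n V c \<longleftrightarrow> (\<exists>F. finite F \<and> card F = n \<and> F \<subseteq> V \<inter> {..<c})"

lemma has_points_below_0 [simp]: "has_points_below 0 V c"
  unfolding has_points_below_def by (rule exI[of _ "{}"]) simp

text \<open>A rational separates the largest of the \<open>Suc n\<close> points from the others.
  This recursion leaves only a countable union and the events of hitting an open interval.\<close>

lemma has_points_below_Suc:
  "has_points_below (Suc n) V c \<longleftrightarrow>
     (\<exists>r\<in>\<rat>. r < c \<and> has_points_below n V r \<and> V \<inter> {r<..<c} \<noteq> {})"
proof
  assume "has_points_below (Suc n) V c"
  then obtain F where F: "finite F" "card F = Suc n" "F \<subseteq> V \<inter> {..<c}"
    unfolding has_points_below_def by blast
  then have ne: "F \<noteq> {}" by auto
  define m where "m = Max F"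
  have m: "m \<in> F" "\<And>x. x \<in> F \<Longrightarrow> x \<le> m" using F(1) ne by (auto simp: m_def)
  define F' where "F' = F - {m}"
  have F': "finite F'" "card F' = n" using F m by (auto simp: F'_def)
  \<comment> \<open>The gap between \<open>b\<close> and the maximum \<open>m\<close> leaves room
    for the rational; \<open>m - 1\<close> serves when no other points remain.\<close>
  have "\<exists>b<m. \<forall>x\<in>F'. x \<le> b"
  proof (cases "F' = {}")
    case True
    then show ?thesis by (auto intro: exI[of _ "m - 1"])
  next
    case False
    have "Max F' < m" using m F' False Max_in[OF F'(1) False] unfolding F'_def by fastforce
    then show ?thesis using F' by auto
  qed
  then obtain b where b: "b < m" "\<And>x. x \<in> F' \<Longrightarrow> x \<le> b" by blast
  obtain r where r: "r \<in> \<rat>" "b < r" "r < m" using Rats_dense_in_real[OF b(1)] by blast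
  have "has_points_below n V r"
    unfolding has_points_below_def using F' F(3) b r
    by (intro exI[of _ F']) (fastforce simp: F'_def)
  moreover have "m \<in> V \<inter> {r<..<c}" using m F(3) r by auto
  ultimately show "\<exists>r\<in>\<rat>. r < c \<and> has_points_below n V r \<and> V \<inter> {r<..<c} \<noteq> {}"
    using r m F(3) by (intro bexI[of _ r]) auto
next
  assume "\<exists>r\<in>\<rat>. r < c \<and> has_points_below n V r \<and> V \<inter> {r<..<c} \<noteq> {}"
  then obtain r where "r < c" "has_points_below n V r" "V \<inter> {r<..<c} \<noteq> {}"
    by blast
  moreover from this obtain x where "x \<in> V" "r < x" "x < c" by auto
  moreover from calculation obtain F where "finite F" "card F = n" "F \<subseteq> V \<inter> {..<r}"
    unfolding has_points_below_def by blast
  ultimately show "has_points_below (Suc n) V c"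
    unfolding has_points_below_def
    by (intro exI[of _ "insert x F"]) (auto simp: card_insert_if)
qed

lemma has_points_below_finite:
  assumes "finite V"
  shows "has_points_below n V c \<longleftrightarrow> n \<le> card (V \<inter> {..<c})"
  unfolding has_points_below_def
  by (metis assms card_mono finite_Int obtain_subset_with_card_n)

text \<open>A finite set never has \<open>Suc (card V)\<close> points below any level. An infinite
  set contains \<open>n\<close> points for every \<open>n\<close>, all of them below some natural
  number.\<close>

lemma finite_iff_has_points_below:
  "finite V \<longleftrightarrow> (\<exists>n. \<forall>m::nat. \<not> has_points_below n V (real m))"
proof
  assume "finite V"
  then show "\<exists>n. \<forall>m::nat. \<not> has_points_below n V (real m)"
    by (auto simp: has_points_below_finite not_le less_Suc_eq_le intro!: exI[of _ "Suc (card V)"] card_mono)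
next
  assume "\<exists>n. \<forall>m::nat. \<not> has_points_below n V (real m)"
  then obtain n where n: "\<And>m. \<not> has_points_below n V (real m)" by blast
  show "finite V"
  proof (rule ccontr)
    assume "infinite V"
    then obtain F where F: "finite F" "card F = n" "F \<subseteq> V"
      using infinite_arbitrarily_large by blast
    obtain m where "Max (insert 0 F) < real m" using reals_Archimedean2 by blast
    then have "F \<subseteq> V \<inter> {..<real m}" using F by (auto simp: Max_less_iff)
    then show False using n[of m] F unfolding has_points_below_def by blast
  qed
qed

text \<open>In an increasing list the entries below \<open>c\<close> form an initial segment.
  Positions start at 0, so reaching position \<open>i\<close> takes \<open>Suc i\<close>
  entries.\<close>

lemma nth_less_iff_card:
  fixes xs :: "real list"
  assumes "sorted xs" "distinct xs" "i < length xs"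
  shows "xs ! i < c \<longleftrightarrow> Suc i \<le> card (set xs \<inter> {..<c})"
proof
  assume c: "xs ! i < c"
  have "(\<lambda>j. xs ! j) ` {..i} \<subseteq> set xs \<inter> {..<c}"
    using assms c sorted_nth_mono[OF assms(1)] by fastforce
  moreover have "inj_on (\<lambda>j. xs ! j) {..i}"
    using assms by (auto simp: inj_on_def nth_eq_iff_index_eq)
  ultimately show "Suc i \<le> card (set xs \<inter> {..<c})"
    using card_mono[of "set xs \<inter> {..<c}" "(\<lambda>j. xs ! j) ` {..i}"] by (simp add: card_image)
next
  assume k: "Suc i \<le> card (set xs \<inter> {..<c})"
  show "xs ! i < c"
  proof (rule ccontr)
    assume "\<not> xs ! i < c"
    have "set xs \<inter> {..<c} \<subseteq> (\<lambda>j. xs ! j) ` {..<i}"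
    proof
      fix x assume "x \<in> set xs \<inter> {..<c}"
      then obtain j where j: "j < length xs" "xs ! j = x" "x < c"
        by (auto simp: in_set_conv_nth)
      then have "j < i"
        using sorted_nth_mono[OF assms(1), of i j] \<open>\<not> xs ! i < c\<close> by (cases "j < i") auto
      then show "x \<in> (\<lambda>j. xs ! j) ` {..<i}" using j by blast
    qed
    then have "card (set xs \<inter> {..<c}) \<le> card ((\<lambda>j. xs ! j) ` {..<i})"
      by (intro card_mono) auto
    also have "\<dots> \<le> i" using card_image_le[of "{..<i}" "\<lambda>j. xs ! j"] by simp
    finally show False using k by simp
  qed
qed

lemma sorted_list_nth_less_iff:
  fixes V :: "real set"
  assumes "finite V" "1 \<le> l" "l \<le> card V"
  shows "sorted_list_of_set V ! (l - 1) < c \<longleftrightarrow> has_points_below l V c"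
  using nth_less_iff_card[of "sorted_list_of_set V" "l - 1" c] assms
  by (simp add: has_points_below_finite)

section \<open>Order vectors as measurable functionals of the path\<close>

text \<open>The coordinate process: the sample point is the path itself, so notions defined for
  flows become functionals on the Skorokhod space.\<close>

abbreviation (input) canonical :: "real \<Rightarrow> real \<Rightarrow> (real \<Rightarrow> real \<Rightarrow> real) \<Rightarrow> real" where
  "canonical v t x \<equiv> x v t"

text \<open>The condition on \<open>T\<close> puts the final time into \<open>{0..T}\<close>, where
  the restricted path still carries the value of the flow.\<close>

lemma flow_values_path:
  "0 \<le> T \<Longrightarrow> flow_values T canonical (flow_path T X \<omega>) = flow_values T X \<omega>"
  unfolding flow_values_def flow_path_def by (intro image_cong) auto

lemma order_vector_path:
  "0 \<le> T \<Longrightarrow> order_vector T canonical l (flow_path T X \<omega>) = order_vector T X l \<omega>"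
  unfolding order_vector_def by (simp add: flow_values_path)

text \<open>Induction along \<open>has_points_below_Suc\<close>, with hitting events open in the
  Skorokhod topology. The level \<open>c\<close> is generalised because the hypothesis is applied at
  the rational separator.\<close>

lemma sets_has_points_below:
  assumes "0 \<le> T"
  shows "{x \<in> space (skorokhod_borel T). has_points_below n (flow_values T canonical x) c}
    \<in> sets (skorokhod_borel T)"
proof (induction n arbitrary: c)
  case 0
  then show ?case by simp
next
  case (Suc n)
  have hit: "{x \<in> space (skorokhod_borel T). flow_values T canonical x \<inter> {r<..<c} \<noteq> {}}
      \<in> sets (skorokhod_borel T)" for r
  proof -
    have "{x \<in> space (skorokhod_borel T). flow_values T canonical x \<inter> {r<..<c} \<noteq> {}} =
      {x \<in> skorokhod_space (path_space T). \<exists>v\<in>{0..1}. x v T \<in> {r<..<c}}"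
      unfolding space_skorokhod_borel flow_values_def by blast
    then show ?thesis
      using openin_in_sets_skorokhod_borel[OF hitting_openin[of T T "{r<..<c}"]] assms by simp
  qed
  have "{x \<in> space (skorokhod_borel T). has_points_below (Suc n) (flow_values T canonical x) c} =
    (\<Union>r\<in>\<rat> \<inter> {..<c}. {x \<in> space (skorokhod_borel T). has_points_below n (flow_values T canonical x) r}
      \<inter> {x \<in> space (skorokhod_borel T). flow_values T canonical x \<inter> {r<..<c} \<noteq> {}})"
    unfolding has_points_below_Suc by blast
  also have "\<dots> \<in> sets (skorokhod_borel T)"
    using Suc hit countable_rat by (intro sets.countable_UN') auto
  finally show ?case .
qed

lemma order_vector_canonical_measurable:
  fixes l :: "'k::finite \<Rightarrow> nat"
  assumes T: "0 \<le> T" and l: "l \<in> index_tuples"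
  shows "order_vector T canonical l \<in> measurable (skorokhod_borel T) cemetery_borel"
proof -
  let ?S = "skorokhod_borel T"
  let ?V = "flow_values T canonical"
  note [measurable] = sets_has_points_below[OF T]
  have l1: "1 \<le> l i" for i using l by (simp add: index_tuples_def)
  have dom: "(\<forall>i. l i \<le> card (?V x)) \<longleftrightarrow> finite (?V x) \<and> (\<forall>i. \<exists>m::nat. has_points_below (l i) (?V x) (real m))"
    for x
  proof (cases "finite (?V x)")
    case True
    \<comment> \<open>A level above all points; 0 is inserted so that the maximum is taken over a
      nonempty set.\<close>
    obtain m where "Max (insert 0 (?V x)) < real m" using reals_Archimedean2 by blast
    then have eq: "?V x \<inter> {..<real m} = ?V x" using True by (auto simp: Max_less_iff)
    have "(\<exists>m. has_points_below k (?V x) (real m)) \<longleftrightarrow> k \<le> card (?V x)" for k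
    proof
      assume "\<exists>m. has_points_below k (?V x) (real m)"
      then show "k \<le> card (?V x)"
        using True by (auto simp: has_points_below_finite intro: le_trans card_mono)
    next
      assume "k \<le> card (?V x)"
      then have "has_points_below k (?V x) (real m)"
        using True eq by (simp add: has_points_below_finite)
      then show "\<exists>m. has_points_below k (?V x) (real m)" by blast
    qed
    with True show ?thesis by simp
  next
    case False
    \<comment> \<open>\<open>undefined\<close> is just some index: an infinite set has
      \<open>card\<close> 0, while every rank is at least 1.\<close>
    then have "\<not> l undefined \<le> card (?V x)" using l1[of undefined] by simp
    with False show ?thesis by blast
  qed
  have fin[measurable]: "{x \<in> space ?S. finite (?V x)} \<in> sets ?S"
    unfolding finite_iff_has_points_below by measurable
  have D[measurable]: "{x \<in> space ?S. \<forall>i. l i \<le> card (?V x)} \<in> sets ?S"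
    unfolding dom by measurable
  show ?thesis
    unfolding order_vector_def
  proof (rule measurable_cemetery_option[OF D])
    fix i
    have "(\<lambda>x. if \<forall>i. l i \<le> card (?V x) then sorted_list_of_set (?V x) ! (l i - 1) else 0)
       \<in> borel_measurable ?S"
    proof (rule borel_measurableI_less)
      fix c :: real
      have "{x \<in> space ?S. (if \<forall>i. l i \<le> card (?V x) then sorted_list_of_set (?V x) ! (l i - 1) else 0) < c}
        = {x \<in> space ?S. if \<forall>i. l i \<le> card (?V x) then has_points_below (l i) (?V x) c else 0 < c}"
        using dom sorted_list_nth_less_iff[OF _ l1] by (intro Collect_cong conj_cong refl) (simp only: split: if_split, blast)
      also have "\<dots> \<in> sets ?S" by measurable
      finally show "{x \<in> space ?S. (if \<forall>i. l i \<le> card (?V x) then sorted_list_of_set (?V x) ! (l i - 1) else 0) < c} \<in> sets ?S" .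
    qed
    then show "(\<lambda>x. if \<forall>i. l i \<le> card (?V x) then (\<chi> i. sorted_list_of_set (?V x) ! (l i - 1)) $ i else 0)
       \<in> borel_measurable ?S" by (simp only: vec_lambda_beta)
  qed
qed

section \<open>Tuples of distinct points and order statistics\<close>

lemma countable_index_tuples: "countable (index_tuples :: ('k::finite \<Rightarrow> nat) set)"
  by (rule countableI_type)

text \<open>A tuple of distinct points is determined by the ranks of its coordinates, and
  distinctness of the coordinates is injectivity of the ranks.\<close>

lemma bij_betw_index_tuples:
  fixes V :: "real set"
  assumes V: "finite V"
  shows "bij_betw (\<lambda>l. \<chi> i. sorted_list_of_set V ! (l i - 1))
    {l \<in> index_tuples. \<forall>i::'k::finite. l i \<le> card V} {v. (\<forall>i. v $ i \<in> V) \<and> inj (\<lambda>i. v $ i)}"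
proof -
  let ?s = "sorted_list_of_set V"
  have len: "length ?s = card V" and set: "set ?s = V" and dist: "distinct ?s" using V by auto
  have nth_inj: "?s ! (a - 1) = ?s ! (b - 1) \<longleftrightarrow> a = b"
    if "1 \<le> a" "a \<le> card V" "1 \<le> b" "b \<le> card V" for a b
    using that nth_eq_iff_index_eq[OF dist, of "a - 1" "b - 1"] len by auto
  show ?thesis
    unfolding bij_betw_def
  proof (intro conjI equalityI subsetI)
    show "inj_on (\<lambda>l. \<chi> i. ?s ! (l i - 1)) {l \<in> index_tuples. \<forall>i::'k. l i \<le> card V}"
    proof (rule inj_onI)
      fix l l' :: "'k \<Rightarrow> nat"
      assume "l \<in> {l \<in> index_tuples. \<forall>i. l i \<le> card V}" "l' \<in> {l \<in> index_tuples. \<forall>i. l i \<le> card V}"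
        and eq: "(\<chi> i. ?s ! (l i - 1)) = (\<chi> i. ?s ! (l' i - 1))"
      then have "1 \<le> l i" "l i \<le> card V" "1 \<le> l' i" "l' i \<le> card V" for i
        by (auto simp: index_tuples_def)
      moreover have "?s ! (l i - 1) = ?s ! (l' i - 1)" for i
        using arg_cong[OF eq, of "\<lambda>v. v $ i"] by simp
      ultimately show "l = l'" using nth_inj by blast
    qed
  next
    fix v :: "real ^ 'k" assume "v \<in> (\<lambda>l. \<chi> i. ?s ! (l i - 1)) ` {l \<in> index_tuples. \<forall>i. l i \<le> card V}"
    then obtain l where l: "inj l" "\<And>i. 1 \<le> l i" "\<And>i. l i \<le> card V"
      and v: "v = (\<chi> i. ?s ! (l i - 1))"
      by (auto simp: index_tuples_def)
    have "v $ i \<in> V" for i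
      using l(2,3)[of i] len nth_mem[of "l i - 1" ?s] set by (simp add: v)
    moreover have "inj (\<lambda>i. v $ i)"
      using l(1) nth_inj[OF l(2) l(3) l(2) l(3)] by (simp add: v inj_def)
    ultimately show "v \<in> {v. (\<forall>i. v $ i \<in> V) \<and> inj (\<lambda>i. v $ i)}" by blast
  next
    fix v :: "real ^ 'k" assume "v \<in> {v. (\<forall>i. v $ i \<in> V) \<and> inj (\<lambda>i. v $ i)}"
    then have v: "\<And>i. v $ i \<in> set ?s" "inj (\<lambda>i. v $ i)" by (auto simp: set)
    then have "\<forall>i. \<exists>j<card V. ?s ! j = v $ i" by (simp add: in_set_conv_nth len)
    then obtain j where j: "\<And>i. j i < card V" "\<And>i. ?s ! j i = v $ i" by metis
    have "inj j" using v(2) j(2) unfolding inj_def by metis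
    \<comment> \<open>\<open>Suc\<close> turns list positions, counted from 0, into ranks, counted
      from 1.\<close>
    then have "(\<lambda>i. Suc (j i)) \<in> {l \<in> index_tuples. \<forall>i. l i \<le> card V}"
      using j(1) by (auto simp: index_tuples_def inj_def Suc_le_eq)
    moreover have "v = (\<chi> i. ?s ! (Suc (j i) - 1))" by (simp add: vec_eq_iff j(2))
    ultimately show "v \<in> (\<lambda>l. \<chi> i. ?s ! (l i - 1)) ` {l \<in> index_tuples. \<forall>i. l i \<le> card V}"
      by (intro image_eqI[where x = "\<lambda>i. Suc (j i)"])
  qed
qed

lemma finite_vec_in: "finite V \<Longrightarrow> finite {v :: 'a ^ 'k::finite. \<forall>i. v $ i \<in> V}"
proof -
  assume "finite V"
  then have "finite (PiE (UNIV :: 'k set) (\<lambda>_. V))" by (simp add: finite_PiE)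
  then have "finite (vec_lambda ` PiE (UNIV :: 'k set) (\<lambda>_. V))" by (rule finite_imageI)
  moreover have "{v :: 'a ^ 'k. \<forall>i. v $ i \<in> V} \<subseteq> vec_lambda ` PiE (UNIV :: 'k set) (\<lambda>_. V)"
    by (auto intro!: image_eqI[of _ _ "vec_nth _"] simp: PiE_def)
  ultimately show ?thesis by (rule rev_finite_subset)
qed

text \<open>Ranks beyond the number of points give \<open>None\<close> and contribute 0, so the sum
  extends to an index set that does not depend on \<open>\<omega>\<close>. The counting-measure form
  prepares the exchange with the expectation.\<close>

lemma sum_tuples_eq_order_vectors:
  fixes B :: "(real ^ 'k::finite) set"
  assumes V: "finite (flow_values T X \<omega>)"
  shows "(\<Sum>\<^sub>\<infinity>v\<in>{v. (\<forall>i. v $ i \<in> flow_values T X \<omega>) \<and> inj (\<lambda>i. v $ i)}. ennreal (indicator B v))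
    = (\<integral>\<^sup>+l. indicator (Some ` B) (order_vector T X l \<omega>) \<partial>count_space index_tuples)"
proof -
  let ?V = "flow_values T X \<omega>"
  let ?A = "{l \<in> index_tuples. \<forall>i::'k. l i \<le> card ?V}"
  let ?t = "\<lambda>l. \<chi> i. sorted_list_of_set ?V ! (l i - 1)"
  let ?W = "{v :: real ^ 'k. (\<forall>i. v $ i \<in> ?V) \<and> inj (\<lambda>i. v $ i)}"
  have bij: "bij_betw ?t ?A ?W" by (rule bij_betw_index_tuples[OF V])
  have finW: "finite ?W" by (rule finite_subset[OF _ finite_vec_in[OF V]]) auto
  then have finA: "finite ?A" using bij_betw_finite[OF bij] by simp
  have "(\<Sum>\<^sub>\<infinity>v\<in>?W. ennreal (indicator B v)) = (\<Sum>v\<in>?W. ennreal (indicator B v))"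
    using finW by simp
  also have "\<dots> = (\<Sum>l\<in>?A. ennreal (indicator B (?t l)))"
    by (rule sum.reindex_bij_betw[OF bij, symmetric])
  also have "\<dots> = (\<Sum>l\<in>?A. indicator (Some ` B) (order_vector T X l \<omega>))"
    by (rule sum.cong) (auto simp: order_vector_def indicator_def)
  also have "\<dots> = (\<integral>\<^sup>+l. indicator (Some ` B) (order_vector T X l \<omega>) \<partial>count_space index_tuples)"
    by (rule nn_integral_count_space'[symmetric]) (use finA in \<open>auto simp: order_vector_def indicator_def\<close>)
  finally show ?thesis .
qed

section \<open>Conditional expectations and summation\<close>

text \<open>The averaging property of conditional expectation for real integrals carries over
  because nonnegativity of \<open>Z\<close> passes to its conditional expectation almost
  everywhere.\<close>

lemma nn_integral_real_cond_exp:
  assumes "finite_measure M" and sub: "subalgebra M F"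
    and Z: "integrable M Z" "\<And>\<omega>. 0 \<le> Z \<omega>" and A: "A \<in> sets F"
  shows "(\<integral>\<^sup>+\<omega>. ennreal (real_cond_exp M F Z \<omega>) * indicator A \<omega> \<partial>M)
    = (\<integral>\<^sup>+\<omega>. ennreal (Z \<omega>) * indicator A \<omega> \<partial>M)"
proof -
  interpret finite_measure M by fact
  interpret finite_measure_subalgebra M F by unfold_locales fact
  have AM: "A \<in> sets M" using A sub by (auto simp: subalgebra_def)
  have ZA: "integrable M (\<lambda>\<omega>. indicator A \<omega> * Z \<omega>)"
    using integrable_mult_indicator[OF AM Z(1)] by simp
  have pos: "AE \<omega> in M. 0 \<le> real_cond_exp M F Z \<omega>"
    using Z by (intro real_cond_exp_pos) auto
  note ce = real_cond_exp_intg[OF ZA borel_measurable_indicator[OF A] borel_measurable_integrable[OF Z(1)]]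
  have "(\<integral>\<^sup>+\<omega>. ennreal (real_cond_exp M F Z \<omega>) * indicator A \<omega> \<partial>M)
     = (\<integral>\<^sup>+\<omega>. ennreal (indicator A \<omega> * real_cond_exp M F Z \<omega>) \<partial>M)"
    by (intro nn_integral_cong) (simp split: split_indicator)
  also have "\<dots> = ennreal (\<integral>\<omega>. indicator A \<omega> * real_cond_exp M F Z \<omega> \<partial>M)"
    using pos by (intro nn_integral_eq_integral ce) (auto elim!: eventually_mono)
  also have "\<dots> = ennreal (\<integral>\<omega>. indicator A \<omega> * Z \<omega> \<partial>M)"
    by (simp add: ce(2))
  also have "\<dots> = (\<integral>\<^sup>+\<omega>. ennreal (indicator A \<omega> * Z \<omega>) \<partial>M)"
    using Z by (intro nn_integral_eq_integral[symmetric] ZA) auto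
  also have "\<dots> = (\<integral>\<^sup>+\<omega>. ennreal (Z \<omega>) * indicator A \<omega> \<partial>M)"
    by (intro nn_integral_cong) (simp split: split_indicator)
  finally show ?thesis .
qed

text \<open>On an event determined by \<open>Y\<close>, \<open>Z\<close> may be replaced by
  \<open>e (Y \<omega>)\<close>; the integral then moves to the law of \<open>Y\<close>, whose
  Euclidean part has density \<open>q\<close>. The sign of \<open>e\<close> is claimed only where
  \<open>q\<close> is positive, since \<open>e\<close> is determined only up to null sets of that
  law.\<close>

lemma nn_integral_cond_exp_order_vector:
  fixes Y :: "'w \<Rightarrow> (real ^ 'k) option"
  assumes "finite_measure M" and Y: "Y \<in> measurable M cemetery_borel"
    and Z: "integrable M Z" "\<And>\<omega>. 0 \<le> Z \<omega>"
    and e: "is_cond_exp_given M cemetery_borel Y Z e"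
    and q: "q \<in> borel_measurable borel"
      "\<And>B. B \<in> sets borel \<Longrightarrow>
        emeasure (distr M cemetery_borel Y) (Some ` B) = (\<integral>\<^sup>+y\<in>B. ennreal (q y) \<partial>lborel)"
  shows "AE y in lborel. 0 < q y \<longrightarrow> 0 \<le> e (Some y)"
    and "\<And>B. B \<in> sets borel \<Longrightarrow> (\<integral>\<^sup>+\<omega>. ennreal (Z \<omega>) * indicator (Some ` B) (Y \<omega>) \<partial>M)
      = (\<integral>\<^sup>+y. ennreal (q y) * ennreal (e (Some y)) * indicator B y \<partial>lborel)"
proof -
  let ?F = "vimage_algebra (space M) Y cemetery_borel"
  let ?N = "distr M cemetery_borel Y"
  let ?K = "density lborel (\<lambda>y. ennreal (q y))"
  interpret finite_measure M by fact
  have sub: "subalgebra M ?F"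
    unfolding subalgebra_def using measurable_sets[OF Y] by (auto simp: sets_vimage_algebra2)
  interpret finite_measure_subalgebra M ?F by unfold_locales (fact sub)
  have em[measurable]: "e \<in> borel_measurable cemetery_borel"
    and eY: "AE \<omega> in M. e (Y \<omega>) = real_cond_exp M ?F Z \<omega>"
    using e by (auto simp: is_cond_exp_given_def)
  note [measurable] = q(1) Y
  have N: "sets ?N = sets cemetery_borel" and K: "sets ?K = sets borel" by simp_all
  have eq: "emeasure ?N (Some ` B) = emeasure ?K B" if "B \<in> sets borel" for B
    using that by (simp add: q(2) emeasure_density)
  have "AE \<omega> in M. 0 \<le> real_cond_exp M ?F Z \<omega>"
    using Z by (intro real_cond_exp_pos) auto
  with eY have "AE \<omega> in M. 0 \<le> e (Y \<omega>)" by eventually_elim simp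
  moreover have pm: "{z. 0 \<le> e z} \<in> sets cemetery_borel"
    using measurable_sets[OF em, of "{0..}"] by (simp add: vimage_def)
  ultimately have "AE z in ?N. 0 \<le> e z"
    by (subst AE_distr_iff[OF Y]) auto
  then have "AE y in ?K. 0 \<le> e (Some y)"
    by - (rule AE_cemetery[OF N K _ _ pm], erule eq, assumption)
  then show "AE y in lborel. 0 < q y \<longrightarrow> 0 \<le> e (Some y)"
    by (subst (asm) AE_density) auto
  fix B :: "(real ^ 'k) set" assume B[measurable]: "B \<in> sets borel"
  \<comment> \<open>The event belongs to the conditioning sigma-algebra, so the averaging property
    applies to it.\<close>
  have A: "Y -` (Some ` B) \<inter> space M \<in> sets ?F"
    by (rule in_vimage_algebra) (simp add: Some_image_in_sets)
  have "(\<integral>\<^sup>+\<omega>. ennreal (Z \<omega>) * indicator (Some ` B) (Y \<omega>) \<partial>M)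
     = (\<integral>\<^sup>+\<omega>. ennreal (Z \<omega>) * indicator (Y -` (Some ` B) \<inter> space M) \<omega> \<partial>M)"
    by (intro nn_integral_cong) (auto simp: indicator_def)
  also have "\<dots> = (\<integral>\<^sup>+\<omega>. ennreal (real_cond_exp M ?F Z \<omega>) * indicator (Y -` (Some ` B) \<inter> space M) \<omega> \<partial>M)"
    by (rule nn_integral_real_cond_exp[symmetric, OF \<open>finite_measure M\<close> sub Z A])
  also have "\<dots> = (\<integral>\<^sup>+\<omega>. ennreal (e (Y \<omega>)) * indicator (Some ` B) (Y \<omega>) \<partial>M)"
    by (rule nn_integral_cong_AE, use eY AE_space in eventually_elim) (auto simp: indicator_def)
  also have "\<dots> = (\<integral>\<^sup>+z. ennreal (e z) * indicator (Some ` B) z \<partial>?N)"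
    by (subst nn_integral_distr[OF Y]) auto
  also have "\<dots> = (\<integral>\<^sup>+z. (ennreal (e z) * indicator (Some ` B) z) * indicator (range Some) z \<partial>?N)"
    by (intro nn_integral_cong) (auto simp: indicator_def)
  also have "\<dots> = (\<integral>\<^sup>+y. ennreal (e (Some y)) * indicator (Some ` B) (Some y) \<partial>?K)"
    by (rule nn_integral_cemetery[OF N K], erule eq) auto
  also have "\<dots> = (\<integral>\<^sup>+y. ennreal (q y) * (ennreal (e (Some y)) * indicator B y) \<partial>lborel)"
  proof -
    have [measurable]: "(\<lambda>y. e (Some y)) \<in> borel_measurable borel"
      by (rule measurable_compose[OF measurable_Some_cemetery em])
    have "indicator (Some ` B) (Some y) = (indicator B y :: ennreal)" for y
      by (auto simp: indicator_def)
    then show ?thesis by (simp add: nn_integral_density)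
  qed
  finally show "(\<integral>\<^sup>+\<omega>. ennreal (Z \<omega>) * indicator (Some ` B) (Y \<omega>) \<partial>M)
      = (\<integral>\<^sup>+y. ennreal (q y) * ennreal (e (Some y)) * indicator B y \<partial>lborel)"
    by (simp add: mult.assoc)
qed

text \<open>Finiteness of the counting-measure integral is absolute summability, which brings a sum
  in \<open>[0,\<infinity>]\<close> back to an unordered sum of reals.\<close>

lemma has_sum_of_nn_integral_count_space:
  fixes g :: "'a \<Rightarrow> real"
  assumes g: "\<And>x. x \<in> A \<Longrightarrow> 0 \<le> g x" and c: "0 \<le> c"
    and eq: "(\<integral>\<^sup>+x. ennreal (g x) \<partial>count_space A) = ennreal c"
  shows "(g has_sum c) A"
proof -
  have int: "integrable (count_space A) g"
    using g eq by (intro integrableI_nonneg) (auto simp: AE_count_space)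
  then have abs: "Infinite_Set_Sum.abs_summable_on g A" by (simp add: abs_summable_on_def)
  have "ennreal (infsetsum g A) = ennreal c"
    using nn_integral_conv_infsetsum[OF abs g] eq by simp
  then have "infsetsum g A = c"
    using c by (simp add: infsetsum_nonneg g)
  moreover have "g summable_on A"
    using abs abs_summable_equivalent abs_summable_summable by blast
  ultimately show ?thesis
    using infsetsum_infsum[OF abs] by (metis has_sum_infsum)
qed

section \<open>Comparison of the two sides as densities\<close>

theorem theorem3p4:
  fixes M :: "'w measure" and M' :: "'v measure"
    and T :: real and a :: "real \<Rightarrow> real"
    and X :: "real \<Rightarrow> real \<Rightarrow> 'w \<Rightarrow> real" and Xa :: "real \<Rightarrow> real \<Rightarrow> 'v \<Rightarrow> real"
    and u :: "nat \<Rightarrow> real" and I J :: "'w \<Rightarrow> real"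
    and p :: "real ^ 'k \<Rightarrow> real"
    and q :: "('k \<Rightarrow> nat) \<Rightarrow> real ^ 'k \<Rightarrow> real"
    and e :: "('k \<Rightarrow> nat) \<Rightarrow> (real ^ 'k) option \<Rightarrow> real"
  assumes T: "T > 0"
    and a_bounded: "bounded (range a)"
    and a_lipschitz: "\<exists>C. C-lipschitz_on UNIV a"
    and X: "arratia_flow M T (\<lambda>_. 0) X"
    and X_finite: "AE \<omega> in M. finite (flow_values T X \<omega>)"
    and Xa: "arratia_flow M' T a Xa"
    and Xa_finite: "AE \<omega> in M'. finite (flow_values T Xa \<omega>)"
    and u_range: "range u \<subseteq> {0..1}"
    and u_dense: "{0..1} \<subseteq> closure (range u)"
    and IJ: "exponent_limits M T a X u I J"
    and girsanov: "flow_law_density M M' T X Xa (stochastic_exponential I J)"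
    and p: "point_density M' T Xa p"
    and q: "\<And>L. L \<in> index_tuples \<Longrightarrow> order_vector_density M T X L (q L)"
    and e: "\<And>L. L \<in> index_tuples \<Longrightarrow>
      is_cond_exp_given M cemetery_borel (order_vector T X L) (stochastic_exponential I J) (e L)"
  shows "AE y in lborel. ((\<lambda>L. q L y * e L (Some y)) has_sum p y) index_tuples"
proof -
  let ?Z = "stochastic_exponential I J"
  have T0: "0 \<le> T" using T by simp
  have "prob_space M" "prob_space M'" using X Xa by (simp_all add: arratia_flow_def)
  then interpret M: prob_space M + M': prob_space M' .
  have P[measurable]: "flow_path T X \<in> measurable M (skorokhod_borel T)"
    and P'[measurable]: "flow_path T Xa \<in> measurable M' (skorokhod_borel T)"
    using X Xa by (simp_all add: arratia_flow_def)
  have [measurable]: "I \<in> borel_measurable M" "J \<in> borel_measurable M"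
    using IJ by (auto simp: exponent_limits_def tendsto_in_L2_def)
  have Zm[measurable]: "?Z \<in> borel_measurable M"
    unfolding stochastic_exponential_def by measurable
  have Z0: "0 \<le> ?Z \<omega>" for \<omega> by (simp add: stochastic_exponential_def)
  obtain h where h[measurable]: "h \<in> borel_measurable (skorokhod_borel T)"
    and Zh: "AE \<omega> in M. ?Z \<omega> = h (flow_path T X \<omega>)"
    and law: "distr M' (skorokhod_borel T) (flow_path T Xa) =
          density (distr M (skorokhod_borel T) (flow_path T X)) (\<lambda>x. ennreal (h x))"
    using girsanov by (auto simp: flow_law_density_def)
  \<comment> \<open>Change of measure in integral form: functionals of the flow with drift are
    integrated over the driftless flow with weight \<open>?Z\<close>.\<close>
  have transfer: "(\<integral>\<^sup>+\<omega>. g (flow_path T Xa \<omega>) \<partial>M') = (\<integral>\<^sup>+\<omega>. ennreal (?Z \<omega>) * g (flow_path T X \<omega>) \<partial>M)"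
    if [measurable]: "g \<in> borel_measurable (skorokhod_borel T)" for g
  proof -
    have "(\<integral>\<^sup>+\<omega>. g (flow_path T Xa \<omega>) \<partial>M') = (\<integral>\<^sup>+x. g x \<partial>distr M' (skorokhod_borel T) (flow_path T Xa))"
      by (simp add: nn_integral_distr)
    also have "\<dots> = (\<integral>\<^sup>+\<omega>. ennreal (h (flow_path T X \<omega>)) * g (flow_path T X \<omega>) \<partial>M)"
      by (simp add: law nn_integral_density nn_integral_distr)
    also have "\<dots> = (\<integral>\<^sup>+\<omega>. ennreal (?Z \<omega>) * g (flow_path T X \<omega>) \<partial>M)"
      by (rule nn_integral_cong_AE, use Zh in eventually_elim) simp
    finally show ?thesis .
  qed
  \<comment> \<open>The constant functional 1 shows that \<open>?Z\<close> has expectation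
    1.\<close>
  have Zi: "integrable M ?Z"
    using transfer[of "\<lambda>_. 1"] Z0 by (intro integrableI_nonneg) (auto simp: M'.emeasure_space_1)
  have OV[measurable]: "order_vector T canonical L \<in> measurable (skorokhod_borel T) cemetery_borel"
    if "L \<in> index_tuples" for L :: "'k \<Rightarrow> nat"
    by (rule order_vector_canonical_measurable[OF T0 that])
  have ovX: "order_vector T X L \<in> measurable M cemetery_borel"
    and ovXa: "order_vector T Xa L \<in> measurable M' cemetery_borel"
    if "L \<in> index_tuples" for L :: "'k \<Rightarrow> nat"
    using measurable_compose[OF P OV[OF that]] measurable_compose[OF P' OV[OF that]]
    by (simp_all add: order_vector_path[OF T0])
  have qm[measurable]: "q L \<in> borel_measurable borel" and q0: "AE y in lborel. 0 \<le> q L y"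
    and qd: "\<And>B. B \<in> sets borel \<Longrightarrow> emeasure (distr M cemetery_borel (order_vector T X L)) (Some ` B)
        = (\<integral>\<^sup>+y\<in>B. ennreal (q L y) \<partial>lborel)"
    if "L \<in> index_tuples" for L
    using q[OF that] by (auto simp: order_vector_density_def)
  have em[measurable]: "(\<lambda>y. e L (Some y)) \<in> borel_measurable borel" if "L \<in> index_tuples" for L
    using e[OF that] unfolding is_cond_exp_given_def
    by (blast intro: measurable_compose[OF measurable_Some_cemetery])
  have ce: "AE y in lborel. 0 < q L y \<longrightarrow> 0 \<le> e L (Some y)"
    "\<And>B. B \<in> sets borel \<Longrightarrow> (\<integral>\<^sup>+\<omega>. ennreal (?Z \<omega>) * indicator (Some ` B) (order_vector T X L \<omega>) \<partial>M)
      = (\<integral>\<^sup>+y. ennreal (q L y) * ennreal (e L (Some y)) * indicator B y \<partial>lborel)"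
    if L: "L \<in> index_tuples" for L
    using nn_integral_cond_exp_order_vector[OF M.finite_measure_axioms ovX[OF L] Zi Z0 e[OF L] qm[OF L]]
      qd[OF L] by blast+
  \<comment> \<open>The right-hand side is first formed in \<open>[0,\<infinity>]\<close>, where
    sums and integrals can be interchanged before summability is known.\<close>
  define G where "G y = (\<integral>\<^sup>+L. ennreal (q L y) * ennreal (e L (Some y)) \<partial>count_space index_tuples)" for y
  have Gm[measurable]: "G \<in> borel_measurable borel"
  proof -
    \<comment> \<open>Joint measurability in \<open>y\<close> and the index follows from
      measurability in \<open>y\<close> for each of the countably many indices.\<close>
    have "(\<lambda>z. ennreal (q (snd z) (fst z)) * ennreal (e (snd z) (Some (fst z))))
        \<in> borel_measurable (borel \<Otimes>\<^sub>M count_space index_tuples)"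
      by (rule measurable_compose_countable'[where g = snd and I = index_tuples
            and f = "\<lambda>L z. ennreal (q L (fst z)) * ennreal (e L (Some (fst z)))"])
        (auto intro: countable_index_tuples)
    then show ?thesis
      unfolding G_def
      by (intro sigma_finite_measure.borel_measurable_nn_integral
          sigma_finite_measure_count_space_countable countable_index_tuples) (simp add: case_prod_beta)
  qed
  have pm[measurable]: "p \<in> borel_measurable borel" and p0: "AE y in lborel. 0 \<le> p y"
    using p by (auto simp: point_density_def)
  have "density lborel (\<lambda>y. ennreal (p y)) = density lborel G"
  proof (rule measure_eqI)
    fix B :: "(real ^ 'k) set" assume "B \<in> sets (density lborel (\<lambda>y. ennreal (p y)))"
    then have B[measurable]: "B \<in> sets borel" by simp
    have "emeasure (density lborel (\<lambda>y. ennreal (p y))) B = (\<integral>\<^sup>+y. ennreal (p y * indicator B y) \<partial>lborel)"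
      by (subst emeasure_density) (auto intro!: nn_integral_cong split: split_indicator)
    also have "\<dots> = (\<integral>\<^sup>+\<omega>. (\<Sum>\<^sub>\<infinity>v\<in>{v. (\<forall>i. v $ i \<in> flow_values T Xa \<omega>) \<and> inj (\<lambda>i. v $ i)}.
        ennreal (indicator B v)) \<partial>M')"
    proof -
      have "bounded (range (indicator B :: _ \<Rightarrow> real))"
        by (rule boundedI[of _ 1]) (auto simp: indicator_def)
      then show ?thesis using p unfolding point_density_def by (simp add: borel_measurable_indicator)
    qed
    also have "\<dots> = (\<integral>\<^sup>+\<omega>. (\<integral>\<^sup>+L. indicator (Some ` B) (order_vector T Xa L \<omega>) \<partial>count_space index_tuples) \<partial>M')"
      by (rule nn_integral_cong_AE, use Xa_finite in eventually_elim) (rule sum_tuples_eq_order_vectors)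
    also have "\<dots> = (\<integral>\<^sup>+L. (\<integral>\<^sup>+\<omega>. indicator (Some ` B) (order_vector T Xa L \<omega>) \<partial>M') \<partial>count_space index_tuples)"
      using ovXa by (intro nn_integral_count_space_nn_integral countable_index_tuples) 
        (auto intro!: measurable_compose[OF _ borel_measurable_indicator] Some_image_in_sets)
    also have "\<dots> = (\<integral>\<^sup>+L. (\<integral>\<^sup>+y. ennreal (q L y) * ennreal (e L (Some y)) * indicator B y \<partial>lborel) \<partial>count_space index_tuples)"
    proof (rule nn_integral_cong)
      fix L :: "'k \<Rightarrow> nat" assume "L \<in> space (count_space index_tuples)"
      then have L: "L \<in> index_tuples" by simp
      \<comment> \<open>The probability that the order vector of \<open>Xa\<close> lies in
        \<open>B\<close> is a path functional, so it transfers to \<open>X\<close> and is then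
        evaluated by conditioning.\<close>
      have "(\<lambda>x. indicator (Some ` B) (order_vector T canonical L x) :: ennreal) \<in> borel_measurable (skorokhod_borel T)"
        by (intro measurable_compose[OF OV[OF L] borel_measurable_indicator] Some_image_in_sets B)
      from transfer[OF this] show "(\<integral>\<^sup>+\<omega>. indicator (Some ` B) (order_vector T Xa L \<omega>) \<partial>M')
          = (\<integral>\<^sup>+y. ennreal (q L y) * ennreal (e L (Some y)) * indicator B y \<partial>lborel)"
        by (simp add: order_vector_path[OF T0] ce(2)[OF L B])
    qed
    also have "\<dots> = (\<integral>\<^sup>+y. (\<integral>\<^sup>+L. ennreal (q L y) * ennreal (e L (Some y)) * indicator B y \<partial>count_space index_tuples) \<partial>lborel)"
      by (intro nn_integral_count_space_nn_integral[symmetric] countable_index_tuples) auto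
    also have "\<dots> = (\<integral>\<^sup>+y. G y * indicator B y \<partial>lborel)"
      unfolding G_def by (intro nn_integral_cong) (auto simp: nn_integral_multc)
    also have "\<dots> = emeasure (density lborel G) B"
      by (simp add: emeasure_density)
    finally show "emeasure (density lborel (\<lambda>y. ennreal (p y))) B = emeasure (density lborel G) B" .
  qed simp
  then have pG: "AE y in lborel. ennreal (p y) = G y"
    by (intro sigma_finite_measure.density_unique[OF sigma_finite_lborel]) auto
  \<comment> \<open>There are countably many indices, so one null set serves them all.\<close>
  have pos: "AE y in lborel. \<forall>L\<in>index_tuples. 0 \<le> q L y \<and> (0 < q L y \<longrightarrow> 0 \<le> e L (Some y))"
    unfolding AE_ball_countable[OF countable_index_tuples]
    using q0 ce(1) by auto
  show ?thesis
    using pG pos p0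
  proof eventually_elim
    case (elim y)
    \<comment> \<open>Where \<open>q L y\<close> vanishes the product is 0 whatever the sign of
      \<open>e\<close>; elsewhere \<open>e\<close> is nonnegative.\<close>
    have nn: "0 \<le> q L y * e L (Some y)" if "L \<in> index_tuples" for L
      using elim(2) that by (cases "q L y = 0") (auto simp: less_le)
    have "(\<integral>\<^sup>+L. ennreal (q L y * e L (Some y)) \<partial>count_space index_tuples) = G y"
      unfolding G_def using elim(2) by (intro nn_integral_cong) (simp add: ennreal_mult')
    \<comment> \<open>\<open>G y\<close> equals \<open>ennreal (p y)\<close> and is therefore
      finite, which yields convergence to the real number \<open>p y\<close>.\<close>
    with elim show ?case
      by (intro has_sum_of_nn_integral_count_space nn) auto
  qed
qed

end
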